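(* Let $P(z)=\sum_{i=1}^k a_{m_i}z^{m_i}\in\mathbb{Z}[z]$ be a non-constant polynomial with positive integer exponents $m_1,\dots,m_k$, where $a_{m_i}\neq0$ for all $i\in[1,k]$ (so $P(0)=0$). Let $\Omega_P=P^{-1}(B(0,1))\cap B(0,1)$. Let $S\subseteq\Omega_P\cap\overline{\mathbb{Q}}$ be a set closed under complex conjugation, with $0\in S$, such that for every $\alpha\in S$ all complex roots of the polynomial $P(z)-P(\alpha)$ lie in $S$. Then there are uncountably many transcendental functions $\psi(z)$, analytic in $\Omega_P$ and with integer (Taylor) coefficients, such that \[ S_\psi=S\qquad\text{and}\qquad \underline{\delta}(L_0(\psi))\ge 1-\frac{1}{\gcd(m_1,\ldots,m_k)}, \] where by convention $\gcd(m_1,\ldots,m_k)=m_1$ when $k=1$.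
   Context: $B(0,1)$ is the open unit disc and $\overline{\mathbb{Q}}$ the set of algebraic numbers. The exceptional set of $\psi$ is $S_\psi=\{\alpha\in\overline{\mathbb{Q}}\cap\Omega_P:\psi(\alpha)\in\overline{\mathbb{Q}}\}$. For $\psi(z)=\sum_{n\ge0}b_nz^n$ (expansion at $0$), $L_0(\psi)=\{n\ge0:b_n=0\}$, and for $\mathcal{A}\subseteq\mathbb{Z}_{\ge0}$ the lower asymptotic density is $\underline{\delta}(\mathcal{A})=\liminf_{n\to\infty}\#(\mathcal{A}\cap[0,n])/n$. A function is transcendental if it is not algebraic over $\mathbb{C}(z)$. *)

theory Defs
  imports "HOL-Complex_Analysis.Complex_Analysis"
begin

abbreviation cpoly_of_int :: "int poly \<Rightarrow> complex poly" where
  "cpoly_of_int P \<equiv> map_poly of_int P"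

definition Omega :: "int poly \<Rightarrow> complex set" where
  "Omega P = poly (cpoly_of_int P) -` ball 0 1 \<inter> ball 0 1"

(* Q is a polynomial in w with coefficients in C[z], evaluated at w = f z.  Allowing
   coefficients in C(z) gives the same notion, by clearing denominators. *)
definition algebraic_function_on :: "complex set \<Rightarrow> (complex \<Rightarrow> complex) \<Rightarrow> bool" where
  "algebraic_function_on U f \<longleftrightarrow>
     (\<exists>Q :: complex poly poly. Q \<noteq> 0 \<and> (\<forall>z\<in>U. poly (poly Q [:f z:]) z = 0))"

definition transcendental_function_on :: "complex set \<Rightarrow> (complex \<Rightarrow> complex) \<Rightarrow> bool" where
  "transcendental_function_on U f \<longleftrightarrow> \<not> algebraic_function_on U f"

definition exceptional_set :: "complex set \<Rightarrow> (complex \<Rightarrow> complex) \<Rightarrow> complex set" where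
  "exceptional_set U f = {\<alpha>. algebraic \<alpha> \<and> \<alpha> \<in> U \<and> algebraic (f \<alpha>)}"

definition taylor_coeff :: "(complex \<Rightarrow> complex) \<Rightarrow> nat \<Rightarrow> complex" where
  "taylor_coeff f n = fps_nth (fps_expansion f 0) n"

definition zero_coeffs :: "(complex \<Rightarrow> complex) \<Rightarrow> nat set" where
  "zero_coeffs f = {n. taylor_coeff f n = 0}"

definition lower_density :: "nat set \<Rightarrow> ereal" where
  "lower_density A = liminf (\<lambda>n. ereal (real (card (A \<inter> {0..n})) / real n))"

end

theory Submission
  imports Defs
begin

text \<open>
  Take \<open>\<psi> = F \<circ> P\<close>, where \<open>F\<close> is an integer power series converging on the unit disc whose value
  at a point \<open>P \<alpha>\<close> (\<open>\<alpha>\<close> algebraic in \<open>\<Omega>\<^sub>P\<close>) is algebraic precisely when \<open>P \<alpha> \<in> P S\<close>; the root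
  condition on \<open>S\<close> says that \<open>P \<alpha> \<in> P S\<close> means \<open>\<alpha> \<in> S\<close>. The Taylor coefficients of \<open>\<psi>\<close> live in
  degrees divisible by the gcd of the exponents, which gives the density bound.

  Let \<open>B\<close> be the countable set of relevant points in the closed upper half disc. Each \<open>b \<in> B\<close>
  enters at its own time \<open>\<tau> b\<close>; let \<open>A\<^sub>k\<close> be the finite set of points that entered before \<open>k\<close> and
  let \<open>Q\<^sub>k\<close> be the product of \<open>(1 - z / a) (1 - z / cnj a)\<close> over \<open>a \<in> A\<^sub>k\<close>, a real polynomial with
  constant term 1. Then \<open>F = \<Sum>\<^sub>k z\<^sup>k r\<^sub>k\<close> with \<open>r\<^sub>k = (s + t z) Q\<^sub>k + c Q\<^sub>k\<^sub>+\<^sub>1\<close> for bounded real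
  numbers \<open>s\<close>, \<open>t\<close>, \<open>c\<close>. Adding \<open>z\<^sup>k r\<^sub>k\<close> does not change the values at points that entered earlier; \<open>s\<close> and
  \<open>t\<close> move the value at the point entering at time \<open>k\<close> into or out of the algebraic numbers, and
  \<open>c\<close> makes the \<open>k\<close>-th coefficient an integer. If the points enter slowly, the coefficients of \<open>F\<close>
  grow polynomially, so \<open>F\<close> converges on the disc. Each integer coefficient can moreover avoid one
  prescribed value, so by diagonalisation there are uncountably many such \<open>F\<close>.

  Only countably many integer power series are algebraic over \<open>\<complex>(z)\<close>: a \<open>\<rat>\<close>-linear functional
  \<open>\<complex> \<rightarrow> \<rat>\<close> applied to the coefficients of a polynomial relation yields a rational one.
\<close>

subsection \<open>Algebraic power series with rational coefficients\<close>

definition algebraic_fps :: "'a::comm_ring_1 fps \<Rightarrow> bool" where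
  "algebraic_fps \<phi> \<longleftrightarrow> (\<exists>Q :: 'a poly poly. Q \<noteq> 0 \<and> poly (map_poly fps_of_poly Q) \<phi> = 0)"

lemma countable_polys_over:
  assumes "countable C"
  shows "countable {p. \<forall>i. coeff p i \<in> C}"
proof (rule countable_subset)
  show "{p. \<forall>i. coeff p i \<in> C} \<subseteq> Poly ` lists C"
  proof
    fix p assume "p \<in> {p. \<forall>i. coeff p i \<in> C}"
    then have "range (coeff p) \<subseteq> C"
      by blast
    then have "set (coeffs p) \<subseteq> C"
      by (simp add: range_coeff)
    then show "p \<in> Poly ` lists C"
      by (intro image_eqI[of _ _ "coeffs p"]) (auto simp: lists_eq_set)
  qed
  show "countable (Poly ` lists C)"
    using assms by simp
qed

lemma countable_algebraic: "countable {x :: 'a::field_char_0. algebraic x}"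
proof (rule countable_subset)
  let ?R = "{p :: 'a poly. \<forall>i. coeff p i \<in> \<rat>} - {0}"
  show "{x :: 'a. algebraic x} \<subseteq> (\<Union>p\<in>?R. {x. poly p x = 0})"
    by (auto simp: algebraic_altdef)
  show "countable (\<Union>p\<in>?R. {x. poly p x = 0})"
  proof (rule countable_UN)
    show "countable ?R"
      by (intro countable_Diff countable_polys_over countable_rat)
  qed (simp add: countable_finite poly_roots_finite)
qed

locale rational_linear = additive h for h :: "'a::field_char_0 \<Rightarrow> 'a" +
  assumes scale_Rats: "q \<in> \<rat> \<Longrightarrow> h (q * x) = q * h x"

lemma exists_rational_linear_functional:
  fixes c :: "'a::field_char_0"
  assumes "c \<noteq> 0"
  obtains h :: "'a \<Rightarrow> 'a" where "rational_linear h" "range h \<subseteq> \<rat>" "h c \<noteq> 0"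
proof -
  interpret V: vector_space "\<lambda>(q::rat) (x::'a). of_rat q * x"
    by unfold_locales (auto simp: of_rat_add of_rat_mult algebra_simps)
  have independent: "V.independent {c}"
    using assms by simp
  let ?B = "V.extend_basis {c}"
  note B = V.independent_extend_basis[OF independent] V.span_extend_basis[OF independent]
  have "c \<in> ?B"
    using V.extend_basis_superset[OF independent] by blast
  define h :: "'a \<Rightarrow> 'a" where "h x = of_rat (V.representation ?B x c)" for x
  show ?thesis
  proof
    show "rational_linear h"
      by unfold_locales
        (auto simp: h_def B V.representation_add V.representation_scale of_rat_add of_rat_mult
          elim!: Rats_cases)
    show "range h \<subseteq> \<rat>"
      by (auto simp: h_def)
    show "h c \<noteq> 0"
      by (simp add: h_def V.representation_basis[OF B(1) \<open>c \<in> ?B\<close>])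
  qed
qed

lemma (in rational_linear) fps_nth_poly_map_poly:
  assumes \<phi>: "\<And>n. fps_nth \<phi> n \<in> \<rat>"
  shows "fps_nth (poly (map_poly fps_of_poly (map_poly (map_poly h) Q)) \<phi>) n =
    h (fps_nth (poly (map_poly fps_of_poly Q) \<phi>) n)"
proof (induction Q arbitrary: n)
  case (pCons q Q)
  let ?E = "\<lambda>Q. poly (map_poly fps_of_poly Q) \<phi>" and ?hQ = "map_poly (map_poly h) Q"
  have "fps_nth (?E (map_poly (map_poly h) (pCons q Q))) n =
      h (coeff q n) + (\<Sum>i=0..n. fps_nth \<phi> i * fps_nth (?E ?hQ) (n - i))"
    by (simp add: map_poly_pCons coeff_map_poly zero fps_mult_nth)
  also have "\<dots> = h (coeff q n) + (\<Sum>i=0..n. h (fps_nth \<phi> i * fps_nth (?E Q) (n - i)))"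
    by (simp add: pCons.IH scale_Rats \<phi>)
  also have "\<dots> = h (fps_nth (?E (pCons q Q)) n)"
    by (simp add: map_poly_pCons fps_mult_nth add sum)
  finally show ?case .
qed (simp add: zero)

lemma algebraic_fps_rational_relation:
  fixes \<phi> :: "'a::field_char_0 fps"
  assumes "algebraic_fps \<phi>" and \<phi>: "\<And>n. fps_nth \<phi> n \<in> \<rat>"
  obtains Q :: "'a poly poly" where "Q \<noteq> 0" "\<And>i j. coeff (coeff Q i) j \<in> \<rat>"
    "poly (map_poly fps_of_poly Q) \<phi> = 0"
proof -
  obtain Q :: "'a poly poly" where Q: "Q \<noteq> 0" "poly (map_poly fps_of_poly Q) \<phi> = 0"
    using assms(1) by (auto simp: algebraic_fps_def)
  then have "lead_coeff (lead_coeff Q) \<noteq> 0"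
    by simp
  then obtain h :: "'a \<Rightarrow> 'a" where "rational_linear h"
      and h: "range h \<subseteq> \<rat>" "h (lead_coeff (lead_coeff Q)) \<noteq> 0"
    by (rule exists_rational_linear_functional)
  then interpret rational_linear h
    by blast
  let ?hQ = "map_poly (map_poly h) Q"
  have coeff_hQ: "coeff (coeff ?hQ i) j = h (coeff (coeff Q i) j)" for i j
    by (simp add: coeff_map_poly zero)
  show ?thesis
  proof
    show "?hQ \<noteq> 0"
      using h(2) coeff_hQ[of "degree Q" "degree (lead_coeff Q)"] by auto
    show "coeff (coeff ?hQ i) j \<in> \<rat>" for i j
      using h(1) by (auto simp: coeff_hQ)
    show "poly (map_poly fps_of_poly ?hQ) \<phi> = 0"
      by (rule fps_ext) (simp add: fps_nth_poly_map_poly \<phi> Q(2) zero)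
  qed
qed

lemma countable_algebraic_fps_Rats:
  "countable {\<phi> :: 'a::field_char_0 fps. algebraic_fps \<phi> \<and> (\<forall>n. fps_nth \<phi> n \<in> \<rat>)}"
proof (rule countable_subset)
  let ?R = "{Q :: 'a poly poly. \<forall>i. coeff Q i \<in> {p. \<forall>j. coeff p j \<in> \<rat>}} - {0}"
  let ?roots = "\<lambda>Q. {\<phi> :: 'a fps. poly (map_poly fps_of_poly Q) \<phi> = 0}"
  show "{\<phi> :: 'a fps. algebraic_fps \<phi> \<and> (\<forall>n. fps_nth \<phi> n \<in> \<rat>)} \<subseteq> (\<Union>Q\<in>?R. ?roots Q)"
    by (auto elim!: algebraic_fps_rational_relation)
  show "countable (\<Union>Q\<in>?R. ?roots Q)"
  proof (rule countable_UN)
    show "countable ?R"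
      by (intro countable_Diff countable_polys_over countable_rat)
  qed (simp add: countable_finite poly_roots_finite map_poly_eq_0_iff)
qed

lemma has_fps_expansion_poly_poly:
  fixes f :: "complex \<Rightarrow> complex"
  assumes f: "f has_fps_expansion \<phi>"
  shows "(\<lambda>z. poly (poly Q [:f z:]) z) has_fps_expansion poly (map_poly fps_of_poly Q) \<phi>"
proof (induction Q)
  case (pCons q Q)
  have "poly q has_fps_expansion fps_of_poly q"
    by (simp add: has_fps_expansion_def)
  then have "(\<lambda>z. poly q z + f z * poly (poly Q [:f z:]) z) has_fps_expansion
      fps_of_poly q + \<phi> * poly (map_poly fps_of_poly Q) \<phi>"
    by (intro has_fps_expansion_add has_fps_expansion_mult f pCons.IH)
  then show ?case
    by (simp add: map_poly_pCons)
qed auto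

lemma algebraic_function_on_imp_algebraic_fps:
  assumes "algebraic_function_on U f" and U: "open U" "0 \<in> U" and f: "f has_fps_expansion \<phi>"
  shows "algebraic_fps \<phi>"
proof -
  obtain Q :: "complex poly poly" where Q: "Q \<noteq> 0" "\<And>z. z \<in> U \<Longrightarrow> poly (poly Q [:f z:]) z = 0"
    using assms(1) by (auto simp: algebraic_function_on_def)
  have "\<forall>\<^sub>F z in nhds 0. poly (poly Q [:f z:]) z = 0"
    using eventually_nhds_in_open[OF U] Q(2) by (rule eventually_mono)
  then have "(\<lambda>z. poly (poly Q [:f z:]) z) has_fps_expansion 0"
    by (simp add: has_fps_expansion_0_iff)
  then have "poly (map_poly fps_of_poly Q) \<phi> = 0"
    using has_fps_expansion_poly_poly[OF f] by (rule fps_expansion_unique_complex[symmetric])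
  with Q(1) show ?thesis
    by (auto simp: algebraic_fps_def)
qed

subsection \<open>Small perturbations\<close>

lemma algebraic_Complex:
  assumes "x \<in> \<rat>" "y \<in> \<rat>"
  shows "algebraic (Complex x y)"
proof (rule algebraicI')
  let ?p = "[:of_real (x\<^sup>2 + y\<^sup>2), of_real (- 2 * x), 1:] :: complex poly"
  show "coeff ?p i \<in> \<rat>" for i
    using assms
    by (auto simp: coeff_pCons split: nat.splits elim!: Rats_cases
        intro!: Rats_add Rats_mult Rats_power)
  show "?p \<noteq> 0"
    by simp
  show "poly ?p (Complex x y) = 0"
    by (auto simp: complex_eq_iff algebra_simps power2_eq_square)
qed

lemma closure_algebraic_complex: "closure {z :: complex. algebraic z} = UNIV"
proof -
  have "(\<Union>f \<in> Basis \<rightarrow> \<rat>. {\<Sum>i::complex\<in>Basis. f i *\<^sub>R i}) \<subseteq> {z. algebraic z}"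
    by (auto simp: Basis_complex_def scaleR_conv_of_real Pi_iff mult.commute
        intro!: algebraic_Complex[unfolded Complex_eq])
  then show ?thesis
    using closure_mono closure_rational_coordinates[where 'a = complex] by blast
qed

lemma open_image_real_combinations:
  fixes a v w :: complex
  assumes "a \<notin> \<real>" "w \<noteq> 0" "open U"
  shows "open ((\<lambda>(s, t). v + (of_real s + of_real t * a) * w) ` U)"
proof -
  let ?f = "\<lambda>(s, t). (of_real s + of_real t * a) * w"
  have "linear ?f"
    by (rule linearI) (auto simp: algebra_simps scaleR_conv_of_real)
  moreover have "surj ?f"
  proof (rule surjI)
    fix z
    have "Im a \<noteq> 0"
      using assms(1) by (simp add: complex_is_Real_iff)
    then have "of_real (Re (z / w) - Im (z / w) / Im a * Re a) + of_real (Im (z / w) / Im a) * a =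
        z / w"
      by (simp add: complex_eq_iff)
    then show "?f (Re (z / w) - Im (z / w) / Im a * Re a, Im (z / w) / Im a) = z"
      using assms(2) by simp
  qed
  ultimately have "open (?f ` U)"
    using assms(3) by (intro open_surjective_linear_image)
  then have "open ((+) v ` ?f ` U)"
    by (rule open_translation)
  then show ?thesis
    by (simp add: image_image case_prod_unfold)
qed

lemma exists_algebraic_perturbation:
  fixes a v w :: complex
  assumes "w \<noteq> 0" and real: "a \<in> \<real> \<Longrightarrow> v \<in> \<real> \<and> w \<in> \<real>"
  obtains s t :: real where "\<bar>s\<bar> \<le> 1" "\<bar>t\<bar> \<le> 1" "algebraic (v + (of_real s + of_real t * a) * w)"
proof (cases "a \<in> \<real>")
  case True
  then obtain v' w' where vw: "v = of_real v'" "w = of_real w'"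
    using real by (auto elim!: Reals_cases)
  then obtain q where q: "q \<in> \<rat>" "v' < q" "q < v' + \<bar>w'\<bar>"
    using Rats_dense_in_real[of v' "v' + \<bar>w'\<bar>"] \<open>w \<noteq> 0\<close> by auto
  have "v + (of_real ((q - v') / w') + of_real 0 * a) * w = of_real q"
    using \<open>w \<noteq> 0\<close> vw by (simp flip: of_real_mult of_real_add)
  moreover have "\<bar>(q - v') / w'\<bar> \<le> 1"
    using q by (simp add: divide_le_eq)
  ultimately show ?thesis
    using that[of "(q - v') / w'" 0] q(1) by (simp add: rat_imp_algebraic)
next
  case False
  let ?f = "\<lambda>(s, t). v + (of_real s + of_real t * a) * w"
  let ?U = "{-1<..<1::real} \<times> {-1<..<1::real}"
  have "open (?f ` ?U)"
    using False \<open>w \<noteq> 0\<close> by (intro open_image_real_combinations open_Times open_greaterThanLessThan)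
  moreover have "?f ` ?U \<noteq> {}"
    by simp
  ultimately have "?f ` ?U \<inter> {z. algebraic z} \<noteq> {}"
    by (simp add: closure_algebraic_complex flip: open_Int_closure_eq_empty)
  then obtain s t where "(s, t) \<in> ?U" "algebraic (?f (s, t))"
    by blast
  then show ?thesis
    using that[of s t] by auto
qed

lemma exists_transcendental_perturbation:
  fixes v w :: complex
  assumes "w \<noteq> 0"
  obtains s :: real where "\<bar>s\<bar> \<le> 1" "\<not> algebraic (v + of_real s * w)"
proof -
  let ?f = "\<lambda>s::real. v + of_real s * w"
  have "inj_on ?f {-1..1}"
    using assms by (auto simp: inj_on_def)
  then have "uncountable (?f ` {-1..1})"
    using countable_image_inj_on uncountable_closed_interval[of "-1" "1::real"] by auto
  then have "\<not> ?f ` {-1..1} \<subseteq> {z. algebraic z}"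
    using countable_algebraic countable_subset by blast
  then obtain s where "s \<in> {-1..1}" "\<not> algebraic (?f s)"
    by blast
  then show ?thesis
    using that[of s] by auto
qed

lemma exists_perturbation:
  fixes a v w :: complex
  assumes "w \<noteq> 0" "a \<in> \<real> \<Longrightarrow> v \<in> \<real> \<and> w \<in> \<real>"
  obtains s t :: real
  where "\<bar>s\<bar> \<le> 1" "\<bar>t\<bar> \<le> 1" "algebraic (v + (of_real s + of_real t * a) * w) \<longleftrightarrow> P"
proof (cases P)
  case True
  then show ?thesis
    using exists_algebraic_perturbation[OF assms] that by metis
next
  case False
  then show ?thesis
    using exists_transcendental_perturbation[OF assms(1), of v] that[of _ 0] by auto
qed

lemma exists_int_translate:
  fixes x d :: complex
  assumes "x \<in> \<real>"
  obtains c where "c \<in> \<real>" "norm c \<le> 2" "x + c \<in> \<int>" "x + c \<noteq> d"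
proof -
  obtain y where y: "x = of_real y"
    using assms by (rule Reals_cases)
  define N where "N = (if of_int \<lceil>y\<rceil> = d then \<lceil>y\<rceil> + 1 else \<lceil>y\<rceil>)"
  have "\<bar>of_int N - y\<bar> \<le> 2"
    unfolding N_def by (auto; linarith)
  moreover have "x + of_real (of_int N - y) = of_int N"
    by (simp add: y)
  moreover have "of_int N \<noteq> d"
    by (auto simp: N_def)
  ultimately show ?thesis
    using that[of "of_real (of_int N - y)"] by (simp del: of_real_diff)
qed

subsection \<open>Polynomials vanishing at finitely many conjugate pairs\<close>

definition conj_pairs_poly :: "complex set \<Rightarrow> complex poly" where
  "conj_pairs_poly A = (\<Prod>a\<in>A. [:1, - (1 / a):] * [:1, - (1 / cnj a):])"

definition poly_length :: "'a::real_normed_vector poly \<Rightarrow> real" where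
  "poly_length p = (\<Sum>i\<le>degree p. norm (coeff p i))"

abbreviation conj_pairs_length :: "complex set \<Rightarrow> real" where
  "conj_pairs_length A \<equiv> poly_length (conj_pairs_poly A)"

lemma coeff_mult_Reals:
  fixes p q :: "'a::{real_algebra_1, comm_semiring_0} poly"
  assumes "\<And>i. coeff p i \<in> \<real>" "\<And>i. coeff q i \<in> \<real>"
  shows "coeff (p * q) i \<in> \<real>"
  using assms by (auto simp: coeff_mult)

lemma poly_in_Reals:
  fixes p :: "'a::{real_algebra_1, comm_semiring_0} poly"
  assumes "\<And>i. coeff p i \<in> \<real>" "z \<in> \<real>"
  shows "poly p z \<in> \<real>"
  using assms by (auto simp: poly_altdef)

lemma poly_length_nonneg: "0 \<le> poly_length p"
  by (simp add: poly_length_def sum_nonneg)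

lemma norm_coeff_le_poly_length: "norm (coeff p i) \<le> poly_length p"
  by (cases "i \<le> degree p")
    (auto simp: poly_length_def coeff_eq_0 sum_nonneg
      intro: member_le_sum[of i _ "\<lambda>i. norm (coeff p i)"])

lemma coeff_0_conj_pairs_poly: "coeff (conj_pairs_poly A) 0 = 1"
  unfolding conj_pairs_poly_def poly_0_coeff_0[symmetric] poly_prod by simp

lemma coeff_conj_pairs_poly_Reals: "coeff (conj_pairs_poly A) i \<in> \<real>"
  unfolding conj_pairs_poly_def
proof (induction A arbitrary: i rule: infinite_finite_induct)
  case (insert a A)
  have "coeff ([:1, - (1 / a):] * [:1, - (1 / cnj a):]) i \<in> \<real>" for i
    by (auto simp: coeff_pCons Reals_cnj_iff split: nat.splits)
  then show ?case
    unfolding prod.insert[OF insert.hyps] by (rule coeff_mult_Reals[OF _ insert.IH])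
qed auto

lemma poly_conj_pairs_poly_eq_0_iff:
  assumes "finite A" "0 \<notin> A"
  shows "poly (conj_pairs_poly A) z = 0 \<longleftrightarrow> z \<in> A \<or> cnj z \<in> A"
proof -
  have "poly ([:1, - (1 / a):] * [:1, - (1 / cnj a):]) z = 0 \<longleftrightarrow> z = a \<or> cnj z = a" if "a \<in> A" for a
    using that assms(2) by (auto simp: divide_eq_eq simp del: mult_pCons_left mult_pCons_right)
  then show ?thesis
    using assms(1)
    by (auto simp: conj_pairs_poly_def poly_prod simp del: mult_pCons_left mult_pCons_right)
qed

subsection \<open>Sums of shifted polynomials\<close>

definition shifted_sum :: "(nat \<Rightarrow> 'a::comm_semiring_1 poly) \<Rightarrow> nat \<Rightarrow> 'a poly" where
  "shifted_sum r n = (\<Sum>k<n. monom 1 k * r k)"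

lemma shifted_sum_0: "shifted_sum r 0 = 0"
  and shifted_sum_Suc: "shifted_sum r (Suc n) = shifted_sum r n + monom 1 n * r n"
  by (simp_all add: shifted_sum_def)

lemma coeff_shifted_sum: "coeff (shifted_sum r n) i = (\<Sum>k | k < n \<and> k \<le> i. coeff (r k) (i - k))"
  unfolding shifted_sum_def coeff_sum coeff_monom_mult
  by (intro sum.mono_neutral_cong_right) auto

text \<open>The formal sum of all \<open>X\<^sup>k r\<^sub>k\<close>; its \<open>n\<close>-th coefficient only involves the terms with \<open>k \<le> n\<close>.\<close>

definition shifted_series :: "(nat \<Rightarrow> 'a::comm_semiring_1 poly) \<Rightarrow> 'a fps" where
  "shifted_series r = Abs_fps (\<lambda>n. coeff (shifted_sum r (Suc n)) n)"

lemma coeff_shifted_sum_eq_fps_nth: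
  assumes "i < n"
  shows "coeff (shifted_sum r n) i = fps_nth (shifted_series r) i"
proof -
  have "{k. k < n \<and> k \<le> i} = {k. k < Suc i \<and> k \<le> i}"
    using assms by auto
  then show ?thesis
    by (simp add: shifted_series_def coeff_shifted_sum)
qed

lemma norm_coeff_shifted_sum_le:
  fixes r :: "nat \<Rightarrow> 'a::{comm_semiring_1, real_normed_vector} poly"
  assumes "\<And>k i. norm (coeff (r k) i) \<le> C k"
  shows "norm (coeff (shifted_sum r n) i) \<le> (\<Sum>k\<le>i. C k)"
proof -
  have "norm (coeff (shifted_sum r n) i) \<le> (\<Sum>k | k < n \<and> k \<le> i. C k)"
    unfolding coeff_shifted_sum by (intro sum_norm_le assms)
  also have "\<dots> \<le> (\<Sum>k\<le>i. C k)"
    using order_trans[OF norm_ge_zero assms] by (intro sum_mono2) auto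
  finally show ?thesis .
qed

lemma summable_partial_sums_mult_power:
  fixes C :: "nat \<Rightarrow> real"
  assumes C: "\<And>k. 0 \<le> C k" and summable: "summable (\<lambda>k. C k * \<rho> ^ k)" and \<rho>: "0 \<le> \<rho>" "\<rho> < 1"
  shows "summable (\<lambda>i. (\<Sum>k\<le>i. C k) * \<rho> ^ i)"
proof -
  have "summable (\<lambda>i. \<Sum>k\<le>i. C k * \<rho> ^ k * \<rho> ^ (i - k))"
    using C summable \<rho> by (intro summable_Cauchy_product) (simp_all add: abs_mult)
  moreover have "(\<Sum>k\<le>i. C k * \<rho> ^ k * \<rho> ^ (i - k)) = (\<Sum>k\<le>i. C k) * \<rho> ^ i" for i
    by (auto simp: sum_distrib_right mult.assoc simp flip: power_add intro!: sum.cong)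
  ultimately show ?thesis
    by simp
qed

lemma
  fixes r :: "nat \<Rightarrow> 'a::{real_normed_field, banach} poly"
  assumes bound: "\<And>k i. norm (coeff (r k) i) \<le> C k"
    and summable: "\<And>\<rho>. 0 \<le> \<rho> \<Longrightarrow> \<rho> < 1 \<Longrightarrow> summable (\<lambda>k. C k * \<rho> ^ k)"
  shows fps_conv_radius_shifted_series: "fps_conv_radius (shifted_series r) \<ge> 1"
    and shifted_sum_LIMSEQ:
      "norm x < 1 \<Longrightarrow> (\<lambda>n. poly (shifted_sum r n) x) \<longlonglongrightarrow> eval_fps (shifted_series r) x"
proof -
  define M where "M x i = (\<Sum>k\<le>i. C k) * norm x ^ i" for x :: 'a and i
  have summable_M: "summable (M x)" if "norm x < 1" for x
    unfolding M_def using order_trans[OF norm_ge_zero bound] summable that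
    by (intro summable_partial_sums_mult_power) auto
  have coeff_le_M: "norm (coeff (shifted_sum r n) i * x ^ i) \<le> M x i" for n i x
    unfolding M_def norm_mult norm_power
    by (intro mult_right_mono norm_coeff_shifted_sum_le bound) auto
  have "summable (\<lambda>i. fps_nth (shifted_series r) i * of_real \<rho> ^ i)" if "0 < \<rho>" "ereal \<rho> < 1" for \<rho>
  proof (rule summable_comparison_test')
    show "summable (M (of_real \<rho>))"
      using that by (intro summable_M) simp
    show "norm (fps_nth (shifted_series r) i * of_real \<rho> ^ i) \<le> M (of_real \<rho>) i" for i
      using coeff_le_M[of "Suc i" i] by (simp add: coeff_shifted_sum_eq_fps_nth)
  qed
  then show "fps_conv_radius (shifted_series r) \<ge> 1"
    unfolding fps_conv_radius_def by (intro conv_radius_geI_ex')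
  show "(\<lambda>n. poly (shifted_sum r n) x) \<longlonglongrightarrow> eval_fps (shifted_series r) x" if "norm x < 1" for x
  proof -
    have "(\<lambda>n. coeff (shifted_sum r n) i * x ^ i) \<longlonglongrightarrow> fps_nth (shifted_series r) i * x ^ i" for i
      by (intro tendsto_eventually eventually_mono[OF eventually_gt_at_top[of i]])
        (simp add: coeff_shifted_sum_eq_fps_nth)
    then have "(\<lambda>n. \<Sum>i. coeff (shifted_sum r n) i * x ^ i) \<longlonglongrightarrow>
        (\<Sum>i. fps_nth (shifted_series r) i * x ^ i)"
      using tannerys_theorem[of "\<lambda>i n. coeff (shifted_sum r n) i * x ^ i",
          OF _ _ summable_M[OF that], of _ sequentially]
      by (simp add: coeff_le_M case_prod_unfold)
    moreover have "poly p x = (\<Sum>i. coeff p i * x ^ i)" for p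
      using eval_fps_of_poly[of p x] by (simp add: eval_fps_def)
    ultimately show ?thesis
      by (simp add: eval_fps_def)
  qed
qed

lemma eval_shifted_series_eq_poly:
  fixes r :: "nat \<Rightarrow> 'a::{real_normed_field, banach} poly"
  assumes "\<And>k i. norm (coeff (r k) i) \<le> C k"
    and "\<And>\<rho>. 0 \<le> \<rho> \<Longrightarrow> \<rho> < 1 \<Longrightarrow> summable (\<lambda>k. C k * \<rho> ^ k)"
    and "norm x < 1" and zero: "\<And>k. k \<ge> n \<Longrightarrow> poly (r k) x = 0"
  shows "eval_fps (shifted_series r) x = poly (shifted_sum r n) x"
proof (rule LIMSEQ_unique)
  show "(\<lambda>n. poly (shifted_sum r n) x) \<longlonglongrightarrow> eval_fps (shifted_series r) x"
    using assms(1-3) by (rule shifted_sum_LIMSEQ)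
  have "poly (shifted_sum r m) x = poly (shifted_sum r n) x" if "n \<le> m" for m
    using that by (induction rule: dec_induct) (simp_all add: shifted_sum_Suc zero)
  then show "(\<lambda>n. poly (shifted_sum r n) x) \<longlonglongrightarrow> poly (shifted_sum r n) x"
    by (intro tendsto_eventually eventually_mono[OF eventually_ge_at_top[of n]])
qed

lemma shifted_sum_dependent_choice:
  fixes P :: "'a::comm_semiring_1 poly \<Rightarrow> bool"
  assumes "P 0" and step: "\<And>k p. P p \<Longrightarrow> \<exists>r. P (p + monom 1 k * r) \<and> R k p r"
  shows "\<exists>r. \<forall>k. R k (shifted_sum r k) (r k)"
proof -
  have "\<exists>p. \<forall>k. (P (p k) \<and> (k = 0 \<longrightarrow> p k = 0)) \<and> (\<exists>r. p (Suc k) = p k + monom 1 k * r \<and> R k (p k) r)"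
  proof (rule dependent_nat_choice)
    fix p and k :: nat
    assume "P p \<and> (k = 0 \<longrightarrow> p = 0)"
    with step obtain r where "P (p + monom 1 k * r)" "R k p r"
      by blast
    then show "\<exists>p'. (P p' \<and> (Suc k = 0 \<longrightarrow> p' = 0)) \<and> (\<exists>r. p' = p + monom 1 k * r \<and> R k p r)"
      by (intro exI[of _ "p + monom 1 k * r"]) auto
  qed (use \<open>P 0\<close> in auto)
  then obtain p r where p: "p 0 = 0" "\<And>k. p (Suc k) = p k + monom 1 k * r k" "\<And>k. R k (p k) (r k)"
    by metis
  have "p k = shifted_sum r k" for k
    by (induction k) (simp_all add: p(1,2) shifted_sum_0 shifted_sum_Suc)
  with p(3) show ?thesis
    by auto
qed

subsection \<open>Interpolation by integer power series\<close>

lemma strict_mono_less_initial_segment: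
  fixes K :: "nat \<Rightarrow> nat"
  assumes "strict_mono K"
  obtains N where "\<And>n. K n < k \<longleftrightarrow> n < N"
proof
  let ?N = "LEAST n. k \<le> K n"
  have "k \<le> K ?N"
    using strict_mono_imp_increasing[OF assms] by (rule LeastI)
  show "K n < k \<longleftrightarrow> n < ?N" for n
  proof
    assume "K n < k"
    with \<open>k \<le> K ?N\<close> have "K n < K ?N"
      by simp
    then show "n < ?N"
      by (simp add: strict_mono_less[OF assms])
  next
    assume "n < ?N"
    then show "K n < k"
      using not_less_Least[of n "\<lambda>n. k \<le> K n"] by simp
  qed
qed

lemma exists_slow_injection:
  fixes M :: "'a set \<Rightarrow> real"
  assumes "countable B"
  obtains \<tau> :: "'a \<Rightarrow> nat" where "inj_on \<tau> B" "\<And>k. M {b \<in> B. \<tau> b < k} \<le> max (M {}) (real k)"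
proof -
  define e where "e = to_nat_on B"
  define K where "K n = (\<Sum>i\<le>n. Suc (nat \<lceil>M {b \<in> B. e b \<le> i}\<rceil>))" for n
  have "strict_mono K"
    by (simp add: strict_mono_Suc_iff K_def)
  have M_le_K: "M {b \<in> B. e b \<le> n} \<le> K n" for n
  proof -
    have "Suc (nat \<lceil>M {b \<in> B. e b \<le> n}\<rceil>) \<le> K n"
      unfolding K_def by (rule member_le_sum) auto
    then show ?thesis
      by linarith
  qed
  show ?thesis
  proof
    show "inj_on (K \<circ> e) B"
      unfolding e_def using assms \<open>strict_mono K\<close>
      by (intro comp_inj_on inj_on_to_nat_on inj_on_subset[OF strict_mono_imp_inj_on]) auto
    fix k
    obtain N where N: "\<And>n. K n < k \<longleftrightarrow> n < N"
      using strict_mono_less_initial_segment[OF \<open>strict_mono K\<close>] by blast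
    show "M {b \<in> B. (K \<circ> e) b < k} \<le> max (M {}) (real k)"
    proof (cases N)
      case (Suc n)
      then have "M {b \<in> B. (K \<circ> e) b < k} \<le> K n"
        using M_le_K[of n] by (simp add: N less_Suc_eq_le)
      also have "real (K n) \<le> real k"
        using N[of n] Suc by simp
      finally show ?thesis
        by simp
    qed (simp add: N)
  qed
qed

lemma norm_coeff_linear_mult_le:
  fixes p :: "complex poly"
  assumes "\<bar>s\<bar> \<le> 1" "\<bar>t\<bar> \<le> 1"
  shows "norm (coeff ([:of_real s, of_real t:] * p) i) \<le> 2 * poly_length p"
proof -
  have "norm (of_real s * coeff p i) \<le> 1 * poly_length p"
    unfolding norm_mult using assms(1) by (intro mult_mono norm_coeff_le_poly_length) auto
  moreover have "norm (coeff (pCons 0 p) i) \<le> poly_length p"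
    by (cases i) (simp_all add: norm_coeff_le_poly_length poly_length_nonneg)
  then have "norm (of_real t * coeff (pCons 0 p) i) \<le> 1 * poly_length p"
    unfolding norm_mult using assms(2) by (intro mult_mono) auto
  moreover have "coeff ([:of_real s, of_real t:] * p) i =
      of_real s * coeff p i + of_real t * coeff (pCons 0 p) i"
    by (simp add: coeff_pCons split: nat.splits)
  ultimately show ?thesis
    using norm_triangle_ineq[of "of_real s * coeff p i" "of_real t * coeff (pCons 0 p) i"] by simp
qed

lemma exists_steering_poly:
  fixes p :: "complex poly"
  assumes A: "finite A" "0 \<notin> A" and b: "b \<noteq> 0" "b \<notin> A" "cnj b \<notin> A"
    and p: "\<And>i. coeff p i \<in> \<real>"
  obtains q where "\<And>i. coeff q i \<in> \<real>" "\<And>i. norm (coeff q i) \<le> 2 * conj_pairs_length A"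
    "\<And>a. a \<in> A \<Longrightarrow> poly q a = 0" "algebraic (poly (p + monom 1 k * q) b) \<longleftrightarrow> P"
proof -
  let ?Q = "conj_pairs_poly A"
  define w where "w = b ^ k * poly ?Q b"
  have "w \<noteq> 0"
    using b by (simp add: w_def poly_conj_pairs_poly_eq_0_iff[OF A])
  moreover have "poly p b \<in> \<real> \<and> w \<in> \<real>" if "b \<in> \<real>"
    using that by (auto simp: w_def intro!: Reals_mult poly_in_Reals p coeff_conj_pairs_poly_Reals)
  ultimately obtain s t :: real where small: "\<bar>s\<bar> \<le> 1" "\<bar>t\<bar> \<le> 1"
      and steered: "algebraic (poly p b + (of_real s + of_real t * b) * w) \<longleftrightarrow> P"
    by (rule exists_perturbation)
  let ?q = "[:of_real s, of_real t:] * ?Q"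
  show ?thesis
  proof
    show "coeff ?q i \<in> \<real>" for i
      by (rule coeff_mult_Reals)
        (auto simp: coeff_pCons coeff_conj_pairs_poly_Reals split: nat.splits)
    show "norm (coeff ?q i) \<le> 2 * conj_pairs_length A" for i
      using small by (rule norm_coeff_linear_mult_le)
    show "poly ?q a = 0" if "a \<in> A" for a
      using that poly_conj_pairs_poly_eq_0_iff[OF A, of a] by simp
    have "poly (p + monom 1 k * ?q) b = poly p b + (of_real s + of_real t * b) * w"
      by (simp add: w_def poly_monom algebra_simps)
    then show "algebraic (poly (p + monom 1 k * ?q) b) \<longleftrightarrow> P"
      using steered by simp
  qed
qed

lemma exists_steering_poly_upper_half_plane:
  fixes p :: "complex poly"
  assumes A: "finite A" "0 \<notin> A" "\<And>a. a \<in> A \<Longrightarrow> Im a \<ge> 0" and p: "\<And>i. coeff p i \<in> \<real>"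
  obtains q where "\<And>i. coeff q i \<in> \<real>" "\<And>i. norm (coeff q i) \<le> 2 * conj_pairs_length A"
    "\<And>a. a \<in> A \<Longrightarrow> poly q a = 0"
    "b \<noteq> 0 \<Longrightarrow> b \<notin> A \<Longrightarrow> Im b \<ge> 0 \<Longrightarrow> algebraic (poly (p + monom 1 k * q) b) \<longleftrightarrow> P"
proof (cases "b \<noteq> 0 \<and> b \<notin> A \<and> Im b \<ge> 0")
  case True
  have "cnj b \<notin> A"
  proof
    assume "cnj b \<in> A"
    then have "cnj b = b"
      using A(3)[of "cnj b"] True by (simp add: complex_eq_iff)
    with \<open>cnj b \<in> A\<close> True show False
      by simp
  qed
  with True obtain q where "\<And>i. coeff q i \<in> \<real>"
      "\<And>i. norm (coeff q i) \<le> 2 * conj_pairs_length A"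
      "\<And>a. a \<in> A \<Longrightarrow> poly q a = 0" "algebraic (poly (p + monom 1 k * q) b) \<longleftrightarrow> P"
    using exists_steering_poly[OF A(1,2) _ _ _ p, of b k P] by blast
  then show ?thesis
    by (intro that[of q])
next
  case False
  then show ?thesis
    by (intro that[of 0]) (auto simp: poly_length_nonneg)
qed

lemma exists_rounding_poly:
  fixes p :: "complex poly"
  assumes A: "finite A" "0 \<notin> A" and p: "\<And>i. coeff p i \<in> \<real>"
  obtains q where "\<And>i. coeff q i \<in> \<real>" "\<And>i. norm (coeff q i) \<le> 2 * conj_pairs_length A"
    "\<And>a. a \<in> A \<Longrightarrow> poly q a = 0"
    "coeff (p + monom 1 k * q) k \<in> \<int>" "coeff (p + monom 1 k * q) k \<noteq> d"
proof -
  let ?Q = "conj_pairs_poly A"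
  obtain c where real: "c \<in> \<real>" and small: "norm c \<le> 2"
      and rounded: "coeff p k + c \<in> \<int>" "coeff p k + c \<noteq> d"
    using p by (rule exists_int_translate)
  have coeff_k: "coeff (p + monom 1 k * smult c ?Q) k = coeff p k + c"
    by (simp add: coeff_monom_mult coeff_0_conj_pairs_poly)
  show ?thesis
  proof
    show "coeff (smult c ?Q) i \<in> \<real>" for i
      by (simp add: real coeff_conj_pairs_poly_Reals)
    show "norm (coeff (smult c ?Q) i) \<le> 2 * conj_pairs_length A" for i
      unfolding coeff_smult norm_mult using small
      by (intro mult_mono norm_coeff_le_poly_length) auto
    show "poly (smult c ?Q) a = 0" if "a \<in> A" for a
      using that poly_conj_pairs_poly_eq_0_iff[OF A, of a] by simp
    show "coeff (p + monom 1 k * smult c ?Q) k \<in> \<int>" "coeff (p + monom 1 k * smult c ?Q) k \<noteq> d"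
      unfolding coeff_k by (fact rounded)+
  qed
qed

lemma exists_interpolation_increment:
  fixes p :: "complex poly"
  assumes A: "A \<subseteq> A'" "finite A'" "0 \<notin> A'" "\<And>a. a \<in> A' \<Longrightarrow> Im a \<ge> 0"
    and p: "\<And>i. coeff p i \<in> \<real>"
  obtains r where "\<And>i. coeff r i \<in> \<real>"
    "\<And>i. norm (coeff r i) \<le> 2 * conj_pairs_length A + 2 * conj_pairs_length A'"
    "\<And>a. a \<in> A \<Longrightarrow> poly r a = 0"
    "coeff (p + monom 1 k * r) k \<in> \<int>" "coeff (p + monom 1 k * r) k \<noteq> d"
    "b \<in> A' - A \<Longrightarrow> algebraic (poly (p + monom 1 k * r) b) \<longleftrightarrow> P"
proof -
  have "finite A" "0 \<notin> A" "\<And>a. a \<in> A \<Longrightarrow> Im a \<ge> 0"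
    using A finite_subset by blast+
  then obtain q where q_Reals: "\<And>i. coeff q i \<in> \<real>"
      and q_bound: "\<And>i. norm (coeff q i) \<le> 2 * conj_pairs_length A"
      and q_zero: "\<And>a. a \<in> A \<Longrightarrow> poly q a = 0"
      and q_steers: "b \<noteq> 0 \<Longrightarrow> b \<notin> A \<Longrightarrow> Im b \<ge> 0 \<Longrightarrow> algebraic (poly (p + monom 1 k * q) b) \<longleftrightarrow> P"
    using exists_steering_poly_upper_half_plane[OF _ _ _ p, of A b k P] by blast
  have "coeff (p + monom 1 k * q) i \<in> \<real>" for i
    by (simp add: coeff_monom_mult p q_Reals)
  then obtain u where u_Reals: "\<And>i. coeff u i \<in> \<real>"
      and u_bound: "\<And>i. norm (coeff u i) \<le> 2 * conj_pairs_length A'"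
      and u_zero: "\<And>a. a \<in> A' \<Longrightarrow> poly u a = 0"
      and u_rounds: "coeff (p + monom 1 k * q + monom 1 k * u) k \<in> \<int>"
        "coeff (p + monom 1 k * q + monom 1 k * u) k \<noteq> d"
    using exists_rounding_poly[OF A(2,3), of "p + monom 1 k * q" k d] by blast
  have sum: "p + monom 1 k * (q + u) = p + monom 1 k * q + monom 1 k * u"
    by (simp add: algebra_simps)
  show ?thesis
  proof
    show "coeff (q + u) i \<in> \<real>" for i
      by (simp add: q_Reals u_Reals)
    show "norm (coeff (q + u) i) \<le> 2 * conj_pairs_length A + 2 * conj_pairs_length A'" for i
      unfolding coeff_add by (rule norm_triangle_mono[OF q_bound u_bound])
    show "poly (q + u) a = 0" if "a \<in> A" for a
      using that A(1) by (simp add: q_zero u_zero subset_iff)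
    show "coeff (p + monom 1 k * (q + u)) k \<in> \<int>" "coeff (p + monom 1 k * (q + u)) k \<noteq> d"
      unfolding sum by (fact u_rounds)+
    show "algebraic (poly (p + monom 1 k * (q + u)) b) \<longleftrightarrow> P" if "b \<in> A' - A"
    proof -
      have "b \<noteq> 0"
        using that A(3) by auto
      then show ?thesis
        using that q_steers A(4) by (simp add: u_zero)
    qed
  qed
qed

locale slow_interpolation =
  fixes B T :: "complex set" and d :: "nat \<Rightarrow> complex" and \<tau> :: "complex \<Rightarrow> nat"
  assumes inj_time: "inj_on \<tau> B"
    and slow: "conj_pairs_length {b \<in> B. \<tau> b < k} \<le> real k + 1"
    and zero_notin: "0 \<notin> B"
    and Im_nonneg: "b \<in> B \<Longrightarrow> Im b \<ge> 0"
begin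

definition increment :: "nat \<Rightarrow> complex poly \<Rightarrow> complex poly \<Rightarrow> bool" where
  "increment k p r \<longleftrightarrow>
    (\<forall>i. norm (coeff r i) \<le> 6 * real (Suc k)) \<and>
    (\<forall>b\<in>B. \<tau> b < k \<longrightarrow> poly r b = 0) \<and>
    coeff (p + monom 1 k * r) k \<in> \<int> - {d k} \<and>
    (\<forall>b\<in>B. \<tau> b = k \<longrightarrow> (algebraic (poly (p + monom 1 k * r) b) \<longleftrightarrow> b \<in> T))"

lemma finite_entered: "finite {b \<in> B. \<tau> b < k}"
  using inj_time by (intro inj_on_finite[of \<tau> _ "{..<k}"]) (auto intro: inj_on_subset)

lemma exists_increment:
  assumes "\<And>i. coeff p i \<in> \<real>"
  obtains r where "\<And>i. coeff r i \<in> \<real>" "increment k p r"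
proof -
  let ?A = "\<lambda>k. {b \<in> B. \<tau> b < k}" and ?b = "inv_into B \<tau> k"
  have mono: "?A k \<subseteq> ?A (Suc k)"
    by auto
  have upper: "0 \<notin> ?A (Suc k)" "\<And>a. a \<in> ?A (Suc k) \<Longrightarrow> Im a \<ge> 0"
    using zero_notin Im_nonneg by auto
  obtain r where Reals: "\<And>i. coeff r i \<in> \<real>"
      and bound: "\<And>i. norm (coeff r i) \<le>
        2 * conj_pairs_length (?A k) + 2 * conj_pairs_length (?A (Suc k))"
      and zero: "\<And>a. a \<in> ?A k \<Longrightarrow> poly r a = 0"
      and rounded: "coeff (p + monom 1 k * r) k \<in> \<int>" "coeff (p + monom 1 k * r) k \<noteq> d k"
      and steered: "?b \<in> ?A (Suc k) - ?A k \<Longrightarrow> algebraic (poly (p + monom 1 k * r) ?b) \<longleftrightarrow> ?b \<in> T"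
    using exists_interpolation_increment[OF mono finite_entered upper assms, of k "d k" ?b "?b \<in> T"]
    by blast
  have "norm (coeff r i) \<le> 6 * real (Suc k)" for i
    using bound[of i] slow[of k] slow[of "Suc k"] by simp
  moreover have "algebraic (poly (p + monom 1 k * r) b) \<longleftrightarrow> b \<in> T" if "b \<in> B" "\<tau> b = k" for b
    using steered that inv_into_f_eq[OF inj_time that] by simp
  ultimately have "increment k p r"
    using zero rounded by (simp add: increment_def)
  with Reals show ?thesis
    by (rule that)
qed

lemma exists_increments: "\<exists>r. \<forall>k. increment k (shifted_sum r k) (r k)"
proof (rule shifted_sum_dependent_choice)
  fix p :: "complex poly" and k
  assume p: "\<forall>i. coeff p i \<in> \<real>"
  then obtain r where r: "\<And>i. coeff r i \<in> \<real>" "increment k p r"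
    using exists_increment by blast
  with p show "\<exists>r. (\<forall>i. coeff (p + monom 1 k * r) i \<in> \<real>) \<and> increment k p r"
    by (intro exI[of _ r]) (simp add: coeff_monom_mult)
qed simp

lemma exists_int_series:
  assumes "B \<subseteq> ball 0 1"
  obtains F :: "complex fps" where "fps_conv_radius F \<ge> 1" "\<And>n. fps_nth F n \<in> \<int> - {d n}"
    "\<And>b. b \<in> B \<Longrightarrow> algebraic (eval_fps F b) \<longleftrightarrow> b \<in> T"
proof -
  obtain r where r: "\<And>k. increment k (shifted_sum r k) (r k)"
    using exists_increments by blast
  have bound: "norm (coeff (r k) i) \<le> 6 * real (Suc k)" for k i
    using r by (simp add: increment_def)
  have summable: "summable (\<lambda>k. 6 * real (Suc k) * \<rho> ^ k)" if "0 \<le> \<rho>" "\<rho> < 1" for \<rho>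
    using summable_mult[OF sums_summable[OF geometric_deriv_sums[of \<rho>]], of 6] that
    by (simp only: mult.assoc real_norm_def abs_of_nonneg)
  show ?thesis
  proof
    show "fps_conv_radius (shifted_series r) \<ge> 1"
      using bound summable by (rule fps_conv_radius_shifted_series)
    show "fps_nth (shifted_series r) n \<in> \<int> - {d n}" for n
      using r[of n] by (simp add: shifted_series_def shifted_sum_Suc increment_def)
    fix b assume "b \<in> B"
    have "poly (r k) b = 0" if "Suc (\<tau> b) \<le> k" for k
      using r[of k] \<open>b \<in> B\<close> that by (simp add: increment_def)
    then have "eval_fps (shifted_series r) b = poly (shifted_sum r (Suc (\<tau> b))) b"
      using \<open>b \<in> B\<close> assms by (intro eval_shifted_series_eq_poly[OF bound summable]) auto
    then show "algebraic (eval_fps (shifted_series r) b) \<longleftrightarrow> b \<in> T"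
      using r[of "\<tau> b"] \<open>b \<in> B\<close> by (simp only: increment_def shifted_sum_Suc)
  qed
qed

end

lemma exists_interpolating_int_series:
  fixes B T :: "complex set" and d :: "nat \<Rightarrow> complex"
  assumes "countable B" and B: "B \<subseteq> ball 0 1 - {0}" "\<And>b. b \<in> B \<Longrightarrow> Im b \<ge> 0"
  obtains F :: "complex fps" where "fps_conv_radius F \<ge> 1" "\<And>n. fps_nth F n \<in> \<int> - {d n}"
    "\<And>b. b \<in> B \<Longrightarrow> algebraic (eval_fps F b) \<longleftrightarrow> b \<in> T"
proof -
  obtain \<tau> where \<tau>: "inj_on \<tau> B" and length:
      "\<And>k. conj_pairs_length {b \<in> B. \<tau> b < k} \<le> max (conj_pairs_length {}) (real k)"
    using exists_slow_injection[OF assms(1), of conj_pairs_length] by blast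
  have "conj_pairs_length {b \<in> B. \<tau> b < k} \<le> real k + 1" for k
    using length[of k] by (simp add: conj_pairs_poly_def poly_length_def)
  then interpret slow_interpolation B T d \<tau>
    using \<tau> B by unfold_locales auto
  have "B \<subseteq> ball 0 1"
    using B(1) by blast
  then show ?thesis
    using that by (rule exists_int_series)
qed

lemma eval_fps_cnj:
  assumes "\<And>n. fps_nth F n \<in> \<real>" "norm z < fps_conv_radius F"
  shows "eval_fps F (cnj z) = cnj (eval_fps F z)"
proof -
  have "(\<lambda>n. cnj (fps_nth F n * z ^ n)) sums cnj (eval_fps F z)"
    using sums_eval_fps[of z F] assms(2) by (simp only: sums_cnj)
  moreover have "cnj (fps_nth F n) = fps_nth F n" for n
    using assms(1) by (simp add: Reals_cnj_iff)
  ultimately show ?thesis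
    by (simp add: eval_fps_def sums_iff)
qed

lemma algebraic_eval_fps_cnj_iff:
  assumes "\<And>n. fps_nth F n \<in> \<real>" "norm z < fps_conv_radius F"
  shows "algebraic (eval_fps F (cnj z)) \<longleftrightarrow> algebraic (eval_fps F z)"
  by (simp add: eval_fps_cnj[OF assms])

lemma uncountable_if_diagonalisable:
  fixes c :: "'a \<Rightarrow> nat \<Rightarrow> 'b"
  assumes diagonal: "\<And>d. \<exists>x\<in>X. \<forall>n. c x n \<noteq> d n"
  shows "uncountable X"
proof
  assume "countable X"
  obtain x where x: "x \<in> X" "\<forall>n. c x n \<noteq> c (from_nat_into X n) n"
    using diagonal[of "\<lambda>n. c (from_nat_into X n) n"] ..
  then obtain n where "from_nat_into X n = x"
    using from_nat_into_surj[OF \<open>countable X\<close>] by blast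
  with x(2) show False
    by auto
qed

definition interpolating_int_series :: "complex set \<Rightarrow> complex set \<Rightarrow> complex fps set" where
  "interpolating_int_series A T = {F. fps_conv_radius F \<ge> 1 \<and> (\<forall>n. fps_nth F n \<in> \<int>) \<and>
     (\<forall>z\<in>A. algebraic (eval_fps F z) \<longleftrightarrow> z \<in> T)}"

lemma algebraic_eval_int_series_iff_by_reflection:
  assumes radius: "fps_conv_radius F \<ge> 1" and Ints: "\<And>n. fps_nth F n \<in> \<int>" and "norm z < 1"
    and T: "\<And>w. w \<in> T \<Longrightarrow> cnj w \<in> T" "0 \<in> T"
    and upper_half: "\<And>w. w \<in> {z, cnj z} \<Longrightarrow> w \<noteq> 0 \<Longrightarrow> Im w \<ge> 0 \<Longrightarrow>
      algebraic (eval_fps F w) \<longleftrightarrow> w \<in> T"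
  shows "algebraic (eval_fps F z) \<longleftrightarrow> z \<in> T"
proof -
  consider (zero) "z = 0" | (upper) "z \<noteq> 0" "Im z \<ge> 0" | (lower) "cnj z \<noteq> 0" "Im (cnj z) \<ge> 0"
    by force
  then show ?thesis
  proof cases
    case zero
    then show ?thesis
      using T(2) Ints[of 0] by (auto simp: eval_fps_at_0 elim!: Ints_cases)
  next
    case upper
    then show ?thesis
      by (intro upper_half) simp
  next
    case lower
    have "fps_nth F n \<in> \<real>" for n
      using Ints[of n] by (auto elim: Ints_cases)
    moreover have "ereal (norm z) < fps_conv_radius F"
      using \<open>norm z < 1\<close> by (intro less_le_trans[OF _ radius]) simp
    ultimately have "algebraic (eval_fps F (cnj z)) \<longleftrightarrow> algebraic (eval_fps F z)"
      by (rule algebraic_eval_fps_cnj_iff)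
    moreover have "cnj z \<in> T \<longleftrightarrow> z \<in> T"
      using T(1)[of z] T(1)[of "cnj z"] by auto
    ultimately show ?thesis
      using upper_half[of "cnj z"] lower by simp
  qed
qed

lemma uncountable_interpolating_int_series:
  assumes A: "countable A" "A \<subseteq> ball 0 1" and T: "\<And>z. z \<in> T \<Longrightarrow> cnj z \<in> T" "0 \<in> T"
  shows "uncountable (interpolating_int_series A T)"
proof (rule uncountable_if_diagonalisable)
  fix d
  define B where "B = {z \<in> A \<union> cnj ` A. z \<noteq> 0 \<and> Im z \<ge> 0}"
  have "countable B"
    using A(1) by (auto simp: B_def intro: countable_subset[of _ "A \<union> cnj ` A"])
  moreover have "B \<subseteq> ball 0 1 - {0}" "\<And>z. z \<in> B \<Longrightarrow> Im z \<ge> 0"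
    using A(2) by (auto simp: B_def)
  ultimately obtain F where radius: "fps_conv_radius F \<ge> 1"
      and coeffs: "\<And>n. fps_nth F n \<in> \<int> - {d n}"
      and upper_half: "\<And>z. z \<in> B \<Longrightarrow> algebraic (eval_fps F z) \<longleftrightarrow> z \<in> T"
    using exists_interpolating_int_series[of B d T] by blast
  have "algebraic (eval_fps F z) \<longleftrightarrow> z \<in> T" if "z \<in> A" for z
  proof (rule algebraic_eval_int_series_iff_by_reflection[OF radius _ _ T])
    show "norm z < 1"
      using A(2) that by auto
    show "algebraic (eval_fps F w) \<longleftrightarrow> w \<in> T" if "w \<in> {z, cnj z}" "w \<noteq> 0" "Im w \<ge> 0" for w
      using that \<open>z \<in> A\<close> by (intro upper_half) (auto simp: B_def)
  qed (use coeffs in blast)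
  then show "\<exists>F\<in>interpolating_int_series A T. \<forall>n. fps_nth F n \<noteq> d n"
    using radius coeffs by (intro bexI[of _ F]) (simp_all add: interpolating_int_series_def)
qed

subsection \<open>Composition of formal power series\<close>

lemma fps_compose_coeff_Ints:
  fixes F G :: "'a::comm_ring_1 fps"
  assumes "\<And>n. fps_nth F n \<in> \<int>" and G: "\<And>n. fps_nth G n \<in> \<int>"
  shows "fps_nth (F oo G) n \<in> \<int>"
proof -
  have "fps_nth (G ^ i) n \<in> \<int>" for i n
    by (induction i arbitrary: n) (auto simp: fps_mult_nth intro!: G Ints_mult)
  then show ?thesis
    using assms(1) by (auto simp: fps_compose_nth intro!: Ints_mult)
qed

lemma fps_nth_compose_eq_0_if_not_dvd:
  fixes F G :: "'a::comm_ring_1 fps"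
  assumes G: "\<And>n. \<not> g dvd n \<Longrightarrow> fps_nth G n = 0" and "\<not> g dvd n"
  shows "fps_nth (F oo G) n = 0"
proof -
  have "fps_nth (G ^ i) n = 0" if "\<not> g dvd n" for i n
    using that
  proof (induction i arbitrary: n)
    case 0
    then show ?case
      by (cases "n = 0") auto
  next
    case (Suc i)
    have "fps_nth G j * fps_nth (G ^ i) (n - j) = 0" if "j \<le> n" for j
    proof (cases "g dvd j")
      case True
      then have "\<not> g dvd n - j"
        using Suc.prems that dvd_diffD by blast
      then show ?thesis
        by (simp add: Suc.IH)
    qed (simp add: G)
    then show ?case
      by (auto simp only: power_Suc fps_mult_nth atLeastAtMost_iff intro!: sum.neutral)
  qed
  then show ?thesis
    using assms(2) by (simp add: fps_compose_nth)
qed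

lemma inj_fps_compose:
  fixes G :: "'a::idom fps"
  assumes "fps_nth G 0 = 0" "G \<noteq> 0"
  shows "inj (\<lambda>F. F oo G)"
proof (rule injI)
  fix F F' assume "F oo G = F' oo G"
  then have "(F - F') oo G = 0"
    by (simp add: fps_compose_sub_distrib)
  then show "F = F'"
    using fps_compose_eq_0_iff[OF assms(1), of "F - F'"] assms(2) by simp
qed

lemma countable_algebraic_compose:
  fixes G :: "'a::field_char_0 fps"
  assumes X: "\<And>F n. F \<in> X \<Longrightarrow> fps_nth F n \<in> \<int>"
    and G: "\<And>n. fps_nth G n \<in> \<int>" "fps_nth G 0 = 0" "G \<noteq> 0"
  shows "countable {F \<in> X. algebraic_fps (F oo G)}"
proof (rule countable_image_inj_on)
  have "fps_nth (F oo G) n \<in> \<rat>" if "F \<in> X" for F n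
    using fps_compose_coeff_Ints[OF X[OF that] G(1)] Ints_subset_Rats by blast
  then show "countable ((\<lambda>F. F oo G) ` {F \<in> X. algebraic_fps (F oo G)})"
    by (intro countable_subset[OF _ countable_algebraic_fps_Rats]) auto
  show "inj_on (\<lambda>F. F oo G) {F \<in> X. algebraic_fps (F oo G)}"
    using inj_fps_compose[OF G(2,3)] by (rule inj_on_subset) simp
qed

subsection \<open>Composition with an integer polynomial\<close>

abbreviation fps_of_int_poly :: "int poly \<Rightarrow> complex fps" where
  "fps_of_int_poly P \<equiv> fps_of_poly (cpoly_of_int P)"

definition pullback :: "int poly \<Rightarrow> complex fps \<Rightarrow> complex \<Rightarrow> complex" where
  "pullback P F = restrict (eval_fps F \<circ> poly (cpoly_of_int P)) (Omega P)"

lemma mem_Omega_iff: "z \<in> Omega P \<longleftrightarrow> norm (poly (cpoly_of_int P) z) < 1 \<and> norm z < 1"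
  by (auto simp: Omega_def)

lemma open_Omega: "open (Omega P)"
  unfolding Omega_def by (intro open_Int open_vimage continuous_intros open_ball)

lemma zero_mem_Omega: "coeff P 0 = 0 \<Longrightarrow> 0 \<in> Omega P"
  by (simp add: mem_Omega_iff poly_0_coeff_0 coeff_map_poly)

lemma poly_cpoly_of_int_cnj: "poly (cpoly_of_int P) (cnj z) = cnj (poly (cpoly_of_int P) z)"
  by (rule poly_cnj_real[symmetric]) (simp add: coeff_map_poly)

lemma pullback_has_fps_expansion:
  assumes "coeff P 0 = 0" "fps_conv_radius F > 0"
  shows "pullback P F has_fps_expansion (F oo fps_of_int_poly P)"
proof -
  have "poly (cpoly_of_int P) has_fps_expansion fps_of_int_poly P"
    by (simp add: has_fps_expansion_def)
  then have "(eval_fps F \<circ> poly (cpoly_of_int P)) has_fps_expansion (F oo fps_of_int_poly P)"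
    using assms
    by (intro has_fps_expansion_compose eval_fps_has_fps_expansion) (simp_all add: coeff_map_poly)
  moreover have "\<forall>\<^sub>F z in nhds 0. pullback P F z = (eval_fps F \<circ> poly (cpoly_of_int P)) z"
    using eventually_nhds_in_open[OF open_Omega zero_mem_Omega[OF assms(1)]]
    by eventually_elim (simp add: pullback_def)
  ultimately show ?thesis
    by (subst has_fps_expansion_cong) auto
qed

lemma taylor_coeff_pullback:
  assumes "coeff P 0 = 0" "fps_conv_radius F > 0"
  shows "taylor_coeff (pullback P F) n = fps_nth (F oo fps_of_int_poly P) n"
  unfolding taylor_coeff_def fps_expansion_eqI[OF pullback_has_fps_expansion[OF assms]] ..

lemma taylor_coeff_pullback_Ints:
  assumes "coeff P 0 = 0" "fps_conv_radius F > 0" "\<And>n. fps_nth F n \<in> \<int>"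
  shows "taylor_coeff (pullback P F) n \<in> \<int>"
  unfolding taylor_coeff_pullback[OF assms(1,2)]
  by (rule fps_compose_coeff_Ints) (simp_all add: assms(3) coeff_map_poly)

lemma pullback_analytic_on_Omega:
  assumes "fps_conv_radius F \<ge> 1"
  shows "pullback P F analytic_on Omega P"
proof -
  have "ball 0 1 \<subseteq> eball 0 (fps_conv_radius F)"
    using assms by (intro ball_eball_mono) (simp add: one_ereal_def)
  then have "eval_fps F holomorphic_on ball 0 1"
    by (rule holomorphic_on_eval_fps)
  moreover have "poly (cpoly_of_int P) holomorphic_on Omega P"
    by (intro holomorphic_intros)
  moreover have "poly (cpoly_of_int P) ` Omega P \<subseteq> ball 0 1"
    by (auto simp: mem_Omega_iff)
  ultimately have "(eval_fps F \<circ> poly (cpoly_of_int P)) holomorphic_on Omega P"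
    using holomorphic_on_compose_gen by blast
  then have "pullback P F holomorphic_on Omega P"
    by (rule holomorphic_transform) (simp add: pullback_def)
  then show ?thesis
    by (simp add: analytic_on_open open_Omega)
qed

lemma transcendental_pullback:
  assumes "coeff P 0 = 0" "fps_conv_radius F > 0"
    and "\<not> algebraic_fps (F oo fps_of_int_poly P)"
  shows "transcendental_function_on (Omega P) (pullback P F)"
  unfolding transcendental_function_on_def
  using assms algebraic_function_on_imp_algebraic_fps[OF _ open_Omega zero_mem_Omega
      pullback_has_fps_expansion]
  by blast

lemma exceptional_set_pullback:
  assumes "S \<subseteq> Omega P \<inter> {z. algebraic z}"
    and fibres: "\<And>\<alpha> z. \<alpha> \<in> S \<Longrightarrow> poly (cpoly_of_int P) z = poly (cpoly_of_int P) \<alpha> \<Longrightarrow> z \<in> S"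
    and F: "F \<in> interpolating_int_series (poly (cpoly_of_int P) ` (Omega P \<inter> {z. algebraic z}))
      (poly (cpoly_of_int P) ` S)"
  shows "exceptional_set (Omega P) (pullback P F) = S"
proof -
  have "algebraic (pullback P F z) \<longleftrightarrow> z \<in> S" if "z \<in> Omega P" "algebraic z" for z
  proof -
    have "algebraic (pullback P F z) \<longleftrightarrow> poly (cpoly_of_int P) z \<in> poly (cpoly_of_int P) ` S"
      using that F by (auto simp: pullback_def interpolating_int_series_def)
    also have "\<dots> \<longleftrightarrow> z \<in> S"
      using fibres by auto
    finally show ?thesis .
  qed
  then show ?thesis
    using assms(1) by (auto simp: exceptional_set_def)
qed

lemma card_non_multiples_ge:
  fixes Z :: "nat set"
  assumes "\<And>n. \<not> g dvd n \<Longrightarrow> n \<in> Z"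
  shows "n \<le> card (Z \<inter> {0..n}) + n div g"
proof -
  let ?multiples = "(*) g ` {0..n div g}"
  have "{0..n} \<subseteq> (Z \<inter> {0..n}) \<union> ?multiples"
  proof
    fix k assume k: "k \<in> {0..n}"
    show "k \<in> (Z \<inter> {0..n}) \<union> ?multiples"
    proof (cases "g dvd k")
      case True
      then have "k = g * (k div g)"
        by simp
      moreover have "k div g \<in> {0..n div g}"
        using k by (simp add: div_le_mono)
      ultimately show ?thesis
        by blast
    qed (use k assms in simp)
  qed
  then have "card {0..n} \<le> card ((Z \<inter> {0..n}) \<union> ?multiples)"
    by (intro card_mono) auto
  also have "\<dots> \<le> card (Z \<inter> {0..n}) + card ?multiples"
    by (rule card_Un_le)
  also have "card ?multiples \<le> Suc (n div g)"
    using card_image_le[of "{0..n div g}" "(*) g"] by simp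
  finally show ?thesis
    by simp
qed

lemma lower_density_ge_of_non_multiples:
  assumes "\<And>n. \<not> g dvd n \<Longrightarrow> n \<in> Z"
  shows "lower_density Z \<ge> ereal (1 - 1 / real g)"
  unfolding lower_density_def
proof (rule Liminf_bounded)
  show "\<forall>\<^sub>F n in sequentially. ereal (1 - 1 / real g) \<le> ereal (real (card (Z \<inter> {0..n})) / real n)"
    using eventually_gt_at_top[of 0]
  proof eventually_elim
    case (elim n)
    have "n \<le> card (Z \<inter> {0..n}) + n div g"
      using assms by (rule card_non_multiples_ge)
    then have "real n \<le> real (card (Z \<inter> {0..n})) + real (n div g)"
      by (metis of_nat_add of_nat_le_iff)
    also have "real (n div g) \<le> real n / real g"
      by (rule of_nat_div_le_of_nat)
    finally have "real n * (1 - 1 / real g) \<le> real (card (Z \<inter> {0..n}))"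
      by (simp add: algebra_simps)
    then show ?case
      using elim by (simp add: le_divide_eq mult.commute)
  qed
qed

lemma lower_density_zero_coeffs_pullback:
  assumes "coeff P 0 = 0" "fps_conv_radius F > 0" "\<And>n. \<not> g dvd n \<Longrightarrow> coeff P n = 0"
  shows "lower_density (zero_coeffs (pullback P F)) \<ge> ereal (1 - 1 / real g)"
proof (rule lower_density_ge_of_non_multiples)
  fix n assume "\<not> g dvd n"
  then have "fps_nth (F oo fps_of_int_poly P) n = 0"
    using assms(3) by (intro fps_nth_compose_eq_0_if_not_dvd[of g]) (simp_all add: coeff_map_poly)
  then show "n \<in> zero_coeffs (pullback P F)"
    by (simp add: zero_coeffs_def taylor_coeff_pullback[OF assms(1,2)])
qed

lemma inj_on_pullback:
  assumes "coeff P 0 = 0" "P \<noteq> 0"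
  shows "inj_on (pullback P) {F. fps_conv_radius F > 0}"
proof (rule inj_onI, clarify)
  have inj: "inj (\<lambda>F. F oo fps_of_int_poly P)"
    using assms by (intro inj_fps_compose) (simp_all add: coeff_map_poly map_poly_eq_0_iff)
  fix F F' assume F: "fps_conv_radius F > 0" "fps_conv_radius F' > 0" "pullback P F = pullback P F'"
  have "F oo fps_of_int_poly P = F' oo fps_of_int_poly P"
    using pullback_has_fps_expansion[OF assms(1) F(1)] pullback_has_fps_expansion[OF assms(1) F(2)]
    unfolding F(3) by (rule fps_expansion_unique_complex)
  with inj show "F = F'"
    by (rule injD)
qed

definition transcendental_interpolants :: "int poly \<Rightarrow> complex set \<Rightarrow> complex fps set" where
  "transcendental_interpolants P S =
     {F \<in> interpolating_int_series (poly (cpoly_of_int P) ` (Omega P \<inter> {z. algebraic z}))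
       (poly (cpoly_of_int P) ` S). \<not> algebraic_fps (F oo fps_of_int_poly P)}"

lemma uncountable_transcendental_interpolants:
  assumes P: "coeff P 0 = 0" "P \<noteq> 0" and S: "\<And>\<alpha>. \<alpha> \<in> S \<Longrightarrow> cnj \<alpha> \<in> S" "0 \<in> S"
  shows "uncountable (transcendental_interpolants P S)"
proof -
  let ?p = "poly (cpoly_of_int P)"
  let ?\<F> = "interpolating_int_series (?p ` (Omega P \<inter> {z. algebraic z})) (?p ` S)"
  have "uncountable ?\<F>"
  proof (rule uncountable_interpolating_int_series)
    show "countable (?p ` (Omega P \<inter> {z. algebraic z}))"
      by (intro countable_image countable_Int2 countable_algebraic)
    show "cnj w \<in> ?p ` S" if "w \<in> ?p ` S" for w
      using that S(1) by (auto simp flip: poly_cpoly_of_int_cnj)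
    have "?p 0 = 0"
      using P(1) by (simp add: poly_0_coeff_0 coeff_map_poly)
    then show "0 \<in> ?p ` S"
      using S(2) by force
  qed (auto simp: mem_Omega_iff)
  moreover have "countable {F \<in> ?\<F>. algebraic_fps (F oo fps_of_int_poly P)}"
    using P by (intro countable_algebraic_compose)
      (simp_all add: interpolating_int_series_def coeff_map_poly map_poly_eq_0_iff)
  ultimately have "uncountable (?\<F> - {F \<in> ?\<F>. algebraic_fps (F oo fps_of_int_poly P)})"
    by (rule uncountable_minus_countable)
  then show ?thesis
    by (simp add: transcendental_interpolants_def set_diff_eq conj_commute cong: conj_cong)
qed

theorem uncountable_transcendental_functions:
  assumes P: "coeff P 0 = 0" "P \<noteq> 0" and support: "\<And>n. \<not> g dvd n \<Longrightarrow> coeff P n = 0"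
    and S: "S \<subseteq> Omega P \<inter> {z. algebraic z}" "\<And>\<alpha>. \<alpha> \<in> S \<Longrightarrow> cnj \<alpha> \<in> S" "0 \<in> S"
    and fibres: "\<And>\<alpha> z. \<alpha> \<in> S \<Longrightarrow> poly (cpoly_of_int P) z = poly (cpoly_of_int P) \<alpha> \<Longrightarrow> z \<in> S"
  shows "uncountable {\<psi> \<in> extensional (Omega P). \<psi> analytic_on Omega P \<and>
    transcendental_function_on (Omega P) \<psi> \<and> (\<forall>n. taylor_coeff \<psi> n \<in> \<int>) \<and>
    exceptional_set (Omega P) \<psi> = S \<and> lower_density (zero_coeffs \<psi>) \<ge> ereal (1 - 1 / real g)}"
    (is "uncountable ?\<Psi>")
proof -
  let ?\<F> = "transcendental_interpolants P S"
  have radius: "fps_conv_radius F \<ge> 1" "fps_conv_radius F > 0" if "F \<in> ?\<F>" for F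
    using that
    by (auto simp: transcendental_interpolants_def interpolating_int_series_def
        intro: less_le_trans[of 0 1])
  have "pullback P F \<in> ?\<Psi>" if F: "F \<in> ?\<F>" for F
  proof -
    have "pullback P F \<in> extensional (Omega P)"
      by (simp add: pullback_def)
    moreover have "pullback P F analytic_on Omega P"
      using radius(1)[OF F] by (rule pullback_analytic_on_Omega)
    moreover have "transcendental_function_on (Omega P) (pullback P F)"
      using F
      by (intro transcendental_pullback P radius) (auto simp: transcendental_interpolants_def)
    moreover have "taylor_coeff (pullback P F) n \<in> \<int>" for n
      using F by (intro taylor_coeff_pullback_Ints P radius)
        (auto simp: transcendental_interpolants_def interpolating_int_series_def)
    moreover have "exceptional_set (Omega P) (pullback P F) = S"
      using F
      by (intro exceptional_set_pullback[OF S(1) fibres])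
        (simp_all add: transcendental_interpolants_def)
    moreover have "lower_density (zero_coeffs (pullback P F)) \<ge> ereal (1 - 1 / real g)"
      using P(1) radius(2)[OF F] support by (rule lower_density_zero_coeffs_pullback)
    ultimately show ?thesis
      by blast
  qed
  then have "pullback P ` ?\<F> \<subseteq> ?\<Psi>"
    by (rule image_subsetI)
  moreover have "inj_on (pullback P) ?\<F>"
    by (rule inj_on_subset[OF inj_on_pullback[OF P]]) (auto simp: radius)
  then have "uncountable (pullback P ` ?\<F>)"
    using uncountable_transcendental_interpolants[OF P S(2,3)] countable_image_inj_on by blast
  ultimately show ?thesis
    using countable_subset by blast
qed

theorem theorem1p7:
  fixes P :: "int poly" and k :: nat and m :: "nat \<Rightarrow> nat" and a :: "nat \<Rightarrow> int"
    and S :: "complex set"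
  assumes "P = (\<Sum>i=1..k. monom (a (m i)) (m i))"
    and "\<And>i. i \<in> {1..k} \<Longrightarrow> m i > 0"
    and "\<And>i. i \<in> {1..k} \<Longrightarrow> a (m i) \<noteq> 0"
    and "degree P > 0"
    and "S \<subseteq> Omega P \<inter> {z. algebraic z}"
    and "\<And>\<alpha>. \<alpha> \<in> S \<Longrightarrow> cnj \<alpha> \<in> S"
    and "0 \<in> S"
    and "\<And>\<alpha> z. \<alpha> \<in> S \<Longrightarrow> poly (cpoly_of_int P - [:poly (cpoly_of_int P) \<alpha>:]) z = 0 \<Longrightarrow> z \<in> S"
  shows "uncountable {\<psi> \<in> extensional (Omega P).
           \<psi> analytic_on Omega P \<and>
           transcendental_function_on (Omega P) \<psi> \<and>
           (\<forall>n. taylor_coeff \<psi> n \<in> \<int>) \<and>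
           exceptional_set (Omega P) \<psi> = S \<and>
           lower_density (zero_coeffs \<psi>) \<ge> ereal (1 - 1 / real (Gcd (m ` {1..k})))}"
proof (rule uncountable_transcendental_functions)
  have coeff_P: "coeff P n = 0" if "n \<notin> m ` {1..k}" for n
    unfolding assms(1) coeff_sum using that by (intro sum.neutral) auto
  then show "coeff P n = 0" if "\<not> Gcd (m ` {1..k}) dvd n" for n
    using that Gcd_dvd by blast
  have "0 \<notin> m ` {1..k}"
    using assms(2) by (metis image_iff less_irrefl)
  then show "coeff P 0 = 0"
    by (rule coeff_P)
  show "P \<noteq> 0"
    using assms(4) by auto
  show "z \<in> S" if "\<alpha> \<in> S" "poly (cpoly_of_int P) z = poly (cpoly_of_int P) \<alpha>" for \<alpha> z
    using assms(8)[OF that(1)] that(2) by simp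
qed (fact assms)+

end
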